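(* There exist absolute constants $c>0$ and $C>0$ such that the following holds for the online batched bin packing problem with $T$ batches of $q$ items each, $n=Tq$, any bin capacity $B$ and any item-size distribution $\mathcal{D}$ on $\{1,\dots,B\}$. If $$\sqrt{q}\,(\log^{3/4}q)\,e^{c\,\log^{3/2}q}\;\ge\;n,$$ then the expected total number of bins opened by the single-sample OSO algorithm (in the variant in which all samples are drawn once at the beginning of the horizon) is at most $$\mathbb{E}[\mathrm{OPT}]+C\,\frac{n\log^{3/4}q}{\sqrt{q}}.$$
   Context: Online batched bin packing. Over periods $t=1,\dots,T$, a batch $\mathcal{I}^t$ of $q$ items is revealed at period $t$; item $i\in\mathcal{I}^t$ has an integer size $V^t_i\in\{1,\dots,B\}$; all sizes are i.i.d. from $\mathcal{D}$. All bins have capacity $B$, and the goal is to pack all $n=Tq$ items in as few bins as possible. $\mathrm{OPT}$ denotes the (random) minimum number of bins needed to pack all items of $\mathcal{I}^1\cup\dots\cup\mathcal{I}^T$ with full information. Flow formulation. For a (multi)set of items $\mathcal{I}$, let $c_s(\mathcal{I})$ be its number of items of size $s$. Let $\mathcal{F}(\mathcal{I})$ be the set of $(x,z)$ with $x=(x_{ij})_{0\le i<j\le B}$ nonnegative integers and $z$ a nonnegative integer such that there are nonnegative integers $w_0,\dots,w_{B-1}$ with $$\sum_{i=0}^{j-1}x_{ij}-\sum_{k=j+1}^{B}x_{jk}=\begin{cases}-z+w_0 & j=0\\ -w_{j-1}+w_j & 0<j<B\\ -w_{B-1}+z & j=B\end{cases}\qquad\text{and}\qquad \sum_{j=0}^{B-s}x_{j,j+s}=c_s(\mathcal{I})\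 \ \forall s\in\{1,\dots,B\}.$$ Here $x_{ij}$ counts items of size $j-i$ placed starting at position $i$ of a bin, $w_j$ counts loss (wasted-unit) arcs from $j$ to $j+1$, and $z$ is the number of bins opened. Thus $\min\{z:(x,z)\in\mathcal{F}(\mathcal{I})\}$ is the minimum number of bins packing $\mathcal{I}$. Single-sample OSO algorithm (variant). At the start, sample batches $\widetilde{\mathcal{I}}^1,\dots,\widetilde{\mathcal{I}}^T$ of $q$ items each, with i.i.d. sizes from $\mathcal{D}$, independent of the true batches. Then for $t=1,\dots,T$: observe $\mathcal{I}^t$; compute an optimal solution of the integer program in nonnegative integer variables $(x^\tau,z^\tau)_{\tau=t,\dots,T}$ $$\min\ \overline z^{1:t-1}+\sum_{\tau=t}^T z^\tau\quad\text{s.t.}\quad \Big(\overline x^{1:t-1}+\sum_{u=t}^{\tau}x^u,\ \overline z^{1:t-1}+\sum_{u=t}^{\tau}z^u\Big)\in\mathcal{F}\big(\mathcal{I}^{1:t}\cup\widetilde{\mathcal{I}}^{t+1:\tau}\big)\ \ \forall \tau\in\{t,\dots,T\},$$ where $\overline x^{1:t-1}=\sum_{u<t}\overline x^u$ and $\overline z^{1:t-1}=\sum_{u<t}\overline z^u$ are the cumulative past decisions, $\mathcal{I}^{1:t}=\mathcal{I}^1\cup\dots\cup\mathcal{I}^t$ and $\widetilde{\mathcal{I}}^{t+1:\tau}=\widetilde{\mathcal{I}}^{t+1}\cup\dots\cup\widetilde{\mathcal{I}}^{\tau}$ (empty if $\tau=t$); implement the period-$t$ part, $\overline x^t=x^t$,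 $\overline z^t=z^t$. The total cost is $\sum_{t=1}^T\overline z^t$. $\log$ is the natural logarithm, and $\log^{a}q=(\log q)^a$. *)

theory Defs
  imports "HOL-Probability.Probability" "HOL-Library.Multiset"
begin

type_synonym arcs = "nat \<Rightarrow> nat \<Rightarrow> nat"

text \<open>A realisation gives the size \<open>V (t, i)\<close> of item \<open>i\<close> in the batch of period \<open>t\<close>;
  only \<open>1 \<le> t \<le> T\<close> and \<open>1 \<le> i \<le> q\<close> matter.\<close>
type_synonym sizes = "nat \<times> nat \<Rightarrow> nat"

text \<open>A plan assigns to each period \<open>\<tau>\<close> the decision \<open>(x\<^sup>\<tau>, z\<^sup>\<tau>)\<close>.\<close>
type_synonym plan = "nat \<Rightarrow> arcs \<times> nat"

definition batches :: "nat \<Rightarrow> sizes \<Rightarrow> nat \<Rightarrow> nat \<Rightarrow> nat multiset" where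
  "batches q V a b = (\<Sum>u=a..b. image_mset (\<lambda>i. V (u, i)) (mset_set {1..q}))"

text \<open>The least number of bins in a partition of the items into bins of load at most \<open>B\<close>.\<close>
definition opt_bins :: "nat \<Rightarrow> nat multiset \<Rightarrow> nat" where
  "opt_bins B M = (LEAST k. \<exists>P :: nat multiset multiset.
     size P = k \<and> sum_mset P = M \<and> (\<forall>b\<in>#P. sum_mset b \<le> B))"

text \<open>The set \<open>\<F>(M)\<close> for a multiset \<open>M\<close> of item sizes (meant for \<open>B \<ge> 1\<close>).
  Entries \<open>x i j\<close> outside \<open>0 \<le> i < j \<le> B\<close> never occur in the constraints.\<close>
definition flow_set :: "nat \<Rightarrow> nat multiset \<Rightarrow> (arcs \<times> nat) set" where
  "flow_set B M = {(x, z).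
     (\<exists>w :: nat \<Rightarrow> nat. \<forall>j\<in>{0..B}.
        (\<Sum>i\<in>{0..<j}. int (x i j)) - (\<Sum>k\<in>{j+1..B}. int (x j k)) =
          (if j = 0 then - int z + int (w 0)
           else if j < B then - int (w (j - 1)) + int (w j)
           else - int (w (B - 1)) + int z)) \<and>
     (\<forall>s\<in>{1..B}. (\<Sum>j\<in>{0..B-s}. x j (j + s)) = count M s)}"

text \<open>Feasible plans and objective of the integer program of period \<open>t\<close>, given the cumulative
  past decisions \<open>xb\<close>, \<open>zb\<close>. Only the components \<open>t, \<dots>, T\<close> of a plan are variables of
  the program, and only the batches \<open>1, \<dots>, t\<close> of \<open>V\<close> enter.\<close>
definition oso_feasible ::
    "nat \<Rightarrow> nat \<Rightarrow> nat \<Rightarrow> nat \<Rightarrow> sizes \<Rightarrow> sizes \<Rightarrow> arcs \<Rightarrow> nat \<Rightarrow> plan set" where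
  "oso_feasible B q T t V W xb zb = {p. \<forall>\<tau>\<in>{t..T}.
     ((\<lambda>i j. xb i j + (\<Sum>u=t..\<tau>. fst (p u) i j)), zb + (\<Sum>u=t..\<tau>. snd (p u)))
       \<in> flow_set B (batches q V 1 t + batches q W (t + 1) \<tau>)}"

definition oso_objective :: "nat \<Rightarrow> nat \<Rightarrow> nat \<Rightarrow> plan \<Rightarrow> nat" where
  "oso_objective T t zb p = zb + (\<Sum>\<tau>=t..T. snd (p \<tau>))"

text \<open>The integer programs may have several optimal solutions. A solver, applied to the period,
  the observed sizes, the sampled sizes and the cumulative past decisions, fixes a choice of
  an optimal solution; the tie-breaking is otherwise arbitrary.\<close>
type_synonym solver = "nat \<Rightarrow> sizes \<Rightarrow> sizes \<Rightarrow> arcs \<Rightarrow> nat \<Rightarrow> plan"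

definition optimal_solver :: "nat \<Rightarrow> nat \<Rightarrow> nat \<Rightarrow> solver \<Rightarrow> bool" where
  "optimal_solver B q T slv \<longleftrightarrow>
     (\<forall>t\<in>{1..T}. \<forall>V W xb zb. oso_feasible B q T t V W xb zb \<noteq> {} \<longrightarrow>
        is_arg_min (oso_objective T t zb) (\<lambda>p. p \<in> oso_feasible B q T t V W xb zb)
          (slv t V W xb zb))"

text \<open>Information available at period \<open>t\<close>: the sizes in later batches are masked by \<open>0\<close>.\<close>
definition observed :: "nat \<Rightarrow> sizes \<Rightarrow> sizes" where
  "observed t V = (\<lambda>(u, i). if u \<le> t then V (u, i) else 0)"

text \<open>Cumulative decisions of the algorithm after periods \<open>1, \<dots>, t\<close> on true sizes \<open>V\<close> and
  sampled sizes \<open>W\<close>.\<close>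
primrec oso_state :: "solver \<Rightarrow> sizes \<Rightarrow> sizes \<Rightarrow> nat \<Rightarrow> arcs \<times> nat" where
  "oso_state slv V W 0 = ((\<lambda>i j. 0), 0)"
| "oso_state slv V W (Suc t) =
     (let (xb, zb) = oso_state slv V W t;
          (x, z) = slv (Suc t) (observed (Suc t) V) W xb zb (Suc t)
      in ((\<lambda>i j. xb i j + x i j), zb + z))"

definition oso_cost :: "solver \<Rightarrow> nat \<Rightarrow> sizes \<Rightarrow> sizes \<Rightarrow> nat" where
  "oso_cost slv T V W = snd (oso_state slv V W T)"

definition iid_sizes :: "nat \<Rightarrow> nat \<Rightarrow> nat pmf \<Rightarrow> sizes pmf" where
  "iid_sizes T q D = Pi_pmf ({1..T} \<times> {1..q}) 0 (\<lambda>_. D)"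

end

theory Submission imports Defs begin

text \<open>From one period to the next, the integer program changes only in that past decisions become fixed,
  which leaves the old plan admissible, and that the sampled batch of the new period is replaced by the
  true one. Let \<open>N\<close> be the true and
  \<open>M\<close> the sampled batch of that period. In the old plan, each true item can take over the place of a
  sampled item that is at least as large, the rest of that place becoming waste; a true item that
  finds no such partner gets a bin of its own. By a greedy monotone matching, the number of extra bins
  is at most the largest amount by which the true batch has more items of size at least \<open>v\<close> than the
  sampled one, over all thresholds \<open>v\<close>, or 0 if there is no such threshold; this is \<open>excess N M\<close> (\<open>packs_replace_items\<close>,
  \<open>oso_feasible_next\<close>).

  The value of the first program is at most the number of bins of an optimal packing of the first true
  batch together with the samples of all later periods, as the prefixes of such a packing are feasible
  (\<open>oso_feasible_first\<close>). This mixture has the law of the true instance, so its expected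
  number of bins is the expected optimum (\<open>expectation_opt_bins_resampled\<close>). After the last period the
  value of the program is the cost of the algorithm, so the regret is at most the sum of the expected
  excesses of the periods (\<open>oso_cost_le\<close>).

  The excess compares the empirical distributions of two independent samples of size \<open>q\<close> from the same
  law, for which only the thresholds occurring in the first sample matter. A union bound over these
  \<open>q\<close> thresholds and exponential moments of binomial differences give an expected excess of at most
  \<open>5 * sqrt (q * ln q)\<close> (\<open>expectation_excess_le\<close>). This is \<open>O(sqrt q * (ln q) powr (3/4))\<close> per period,
  and \<open>T * sqrt q = n / sqrt q\<close>.

  Feasibility is handled in cut form: waste arcs completing \<open>x\<close> to a flow of value \<open>z\<close>
  exist exactly if no unit cell of the bin is covered by more than \<open>z\<close> arcs of \<open>x\<close> (\<open>flow_set_iff\<close>).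
  This makes feasibility monotone and additive in \<open>x\<close>, so single arcs can be moved freely.\<close>

section \<open>Flows as loads of unit cells\<close>

text \<open>The load of the cell between positions \<open>j\<close> and \<open>j + 1\<close>: the flow of \<open>x\<close> through that cut.\<close>

definition load :: "nat \<Rightarrow> arcs \<Rightarrow> nat \<Rightarrow> nat" where
  "load B x j = (\<Sum>i\<in>{..j}. \<Sum>k\<in>{j+1..B}. x i k)"

definition placed :: "nat \<Rightarrow> arcs \<Rightarrow> nat \<Rightarrow> nat" where
  "placed B x s = (\<Sum>j\<in>{0..B-s}. x j (j + s))"

definition packs :: "nat \<Rightarrow> arcs \<Rightarrow> nat multiset \<Rightarrow> bool" where
  "packs B x M \<longleftrightarrow> (\<forall>s\<in>{1..B}. placed B x s = count M s)"

definition unit_arc :: "nat \<Rightarrow> nat \<Rightarrow> arcs" where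
  "unit_arc a b = (\<lambda>i j. of_bool (i = a \<and> j = b))"

definition arcs_add :: "arcs \<Rightarrow> arcs \<Rightarrow> arcs" where
  "arcs_add x y = (\<lambda>i j. x i j + y i j)"

text \<open>Two neighbouring cuts differ only in the arcs that start or end at the position between them.\<close>

lemma load_Suc:
  assumes "Suc j \<le> B"
  shows "load B x j + (\<Sum>k\<in>{Suc j+1..B}. x (Suc j) k) = load B x (Suc j) + (\<Sum>i\<in>{0..<Suc j}. x i (Suc j))"
proof -
  have *: "{j+1..B} = insert (Suc j) {Suc j+1..B}" using assms by auto
  have "load B x j = (\<Sum>i\<in>{..j}. x i (Suc j)) + (\<Sum>i\<in>{..j}. \<Sum>k\<in>{Suc j+1..B}. x i k)"
    unfolding load_def * by (simp add: sum.distrib)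
  moreover have "load B x (Suc j) = (\<Sum>i\<in>{..j}. \<Sum>k\<in>{Suc j+1..B}. x i k) + (\<Sum>k\<in>{Suc j+1..B}. x (Suc j) k)"
    unfolding load_def by (simp add: add.commute)
  moreover have "{0..<Suc j} = {..j}" by auto
  ultimately show ?thesis by simp
qed

text \<open>Summing the conservation equations of the positions up to \<open>j\<close> shows that items and waste together
  carry \<open>z\<close> units through cell \<open>j\<close>. Hence the waste arc of the cell is determined, and the only
  constraint left is that it be nonnegative.\<close>

lemma flow_set_iff:
  assumes "B \<ge> 1"
  shows "(x, z) \<in> flow_set B M \<longleftrightarrow> (\<forall>j<B. load B x j \<le> z) \<and> packs B x M"
proof -
  have step: "int (load B x j) + (\<Sum>k\<in>{Suc j+1..B}. int (x (Suc j) k))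
      = int (load B x (Suc j)) + (\<Sum>i\<in>{0..<Suc j}. int (x i (Suc j)))" if "Suc j \<le> B" for j
    using arg_cong[OF load_Suc[OF that, of x], of int] by simp
  have loadB: "load B x B = 0" by (simp add: load_def)
  have load0: "load B x 0 = (\<Sum>k\<in>{0+1..B}. x 0 k)" by (simp add: load_def)
  have "(\<exists>w :: nat \<Rightarrow> nat. \<forall>j\<in>{0..B}.
        (\<Sum>i\<in>{0..<j}. int (x i j)) - (\<Sum>k\<in>{j+1..B}. int (x j k)) =
          (if j = 0 then - int z + int (w 0)
           else if j < B then - int (w (j - 1)) + int (w j)
           else - int (w (B - 1)) + int z)) \<longleftrightarrow> (\<forall>j<B. load B x j \<le> z)" (is "?L \<longleftrightarrow> ?R")
  proof
    assume ?L
    then obtain w :: "nat \<Rightarrow> nat" where w: "\<And>j. j \<le> B \<Longrightarrow>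
        (\<Sum>i\<in>{0..<j}. int (x i j)) - (\<Sum>k\<in>{j+1..B}. int (x j k)) =
          (if j = 0 then - int z + int (w 0)
           else if j < B then - int (w (j - 1)) + int (w j)
           else - int (w (B - 1)) + int z)" by auto
    have "j < B \<longrightarrow> int (load B x j) + int (w j) = int z" for j
    proof (induction j)
      case 0
      then show ?case using w[of 0] load0 by auto
    next
      case (Suc j)
      then show ?case using w[of "Suc j"] step[of j] by auto
    qed
    then show ?R by (metis of_nat_add of_nat_le_iff le_add1)
  next
    assume R: ?R
    show ?L
    proof (intro exI[of _ "\<lambda>j. z - load B x j"] ballI)
      fix j assume j: "j \<in> {0..B}"
      show "(\<Sum>i\<in>{0..<j}. int (x i j)) - (\<Sum>k\<in>{j+1..B}. int (x j k)) =
          (if j = 0 then - int z + int (z - load B x 0)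
           else if j < B then - int (z - load B x (j - 1)) + int (z - load B x j)
           else - int (z - load B x (B - 1)) + int z)"
      proof (cases j)
        case 0
        then show ?thesis using R[rule_format, of 0] assms load0 by (simp add: of_nat_diff)
      next
        case (Suc i)
        have "load B x i \<le> z" using R j Suc by auto
        moreover have "load B x j \<le> z" if "j < B" using R that by auto
        ultimately show ?thesis using step[of i] Suc j loadB by (auto simp: of_nat_diff)
      qed
    qed
  qed
  then show ?thesis by (simp add: flow_set_def packs_def placed_def)
qed

lemma load_arcs_add: "load B (arcs_add x y) j = load B x j + load B y j"
  by (simp add: load_def arcs_add_def sum.distrib)

lemma placed_arcs_add: "placed B (arcs_add x y) s = placed B x s + placed B y s"
  by (simp add: placed_def arcs_add_def sum.distrib)

lemma packs_arcs_add: "packs B x M \<Longrightarrow> packs B y N \<Longrightarrow> packs B (arcs_add x y) (M + N)"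
  by (simp add: packs_def placed_arcs_add)

lemma load_empty [simp]: "load B (\<lambda>i j. 0) j = 0"
  by (simp add: load_def)

lemma packs_empty [simp]: "packs B (\<lambda>i j. 0) {#}"
  by (simp add: packs_def placed_def)

lemma load_unit_arc:
  assumes "b \<le> B"
  shows "load B (unit_arc a b) j = of_bool (a \<le> j \<and> j < b)"
proof -
  have "load B (unit_arc a b) j = (\<Sum>i\<in>{..j}. if i = a then (\<Sum>k\<in>{j+1..B}. if k = b then 1 else 0) else 0)"
    unfolding load_def unit_arc_def by (intro sum.cong) auto
  then show ?thesis using assms by (auto simp: sum.delta)
qed

lemma packs_unit_arc:
  assumes "a + s \<le> B"
  shows "packs B (unit_arc a (a + s)) {#s#}"
  unfolding packs_def
proof
  fix r assume "r \<in> {1..B}"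
  have "placed B (unit_arc a (a + s)) r = (\<Sum>j\<in>{0..B-r}. if j = a then of_bool (r = s) else 0)"
    unfolding placed_def unit_arc_def by (rule sum.cong[OF refl]) simp
  also have "\<dots> = (if a \<in> {0..B-r} then of_bool (r = s) else 0)"
    by (rule sum.delta) simp
  also have "\<dots> = count {#s#} r"
    using assms by (cases "r = s") simp_all
  finally show "placed B (unit_arc a (a + s)) r = count {#s#} r" .
qed

text \<open>Since \<open>packs\<close> only counts, an item of a given size may be identified with any arc of that length.\<close>

lemma packs_remove_item:
  assumes "packs B x (add_mset s M)" and s: "s \<in> {1..B}"
  obtains a y where "a + s \<le> B" "x = arcs_add y (unit_arc a (a + s))" "packs B y M"
proof -
  have "placed B x s = Suc (count M s)" using assms by (simp add: packs_def)
  then have "\<exists>a\<in>{0..B-s}. x a (a + s) \<noteq> 0"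
    unfolding placed_def by (intro ccontr[of "Bex _ _"]) simp
  then obtain a where a: "a \<le> B - s" "x a (a + s) > 0" by auto
  define y where "y = (\<lambda>i j. x i j - unit_arc a (a + s) i j)"
  have as: "a + s \<le> B" using a s by auto
  have "x i j = arcs_add y (unit_arc a (a + s)) i j" for i j
    using a by (cases "i = a \<and> j = a + s") (auto simp: y_def arcs_add_def unit_arc_def)
  then have x: "x = arcs_add y (unit_arc a (a + s))" by blast
  have "placed B y r = count M r" if "r \<in> {1..B}" for r
  proof -
    have "placed B x r = placed B y r + placed B (unit_arc a (a + s)) r"
      by (subst x) (rule placed_arcs_add)
    moreover have "placed B x r = count (add_mset s M) r"
      using assms(1) that unfolding packs_def by blast
    moreover have "placed B (unit_arc a (a + s)) r = count {#s#} r"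
      using packs_unit_arc[OF as] that unfolding packs_def by blast
    ultimately show ?thesis by (simp split: if_splits)
  qed
  with as x that show thesis unfolding packs_def by blast
qed

section \<open>Monotone replacement of items\<close>

text \<open>Greedy matching from the largest item of \<open>N\<close> downwards. If \<open>M\<close> still has an item at least as large, the
  new item is placed at the start of its arc, and removing both lowers every
  remaining threshold count of \<open>N\<close> and of \<open>M\<close> by one. Otherwise the threshold condition at this item
  leaves a surplus \<open>d \<ge> 1\<close>, one unit of which pays for a new bin that holds the item.\<close>

lemma packs_replace_items:
  assumes "packs B x M" "set_mset M \<subseteq> {1..B}" "set_mset N \<subseteq> {1..B}"
    and "\<forall>v\<in>#N. size {#u \<in># N. v \<le> u#} \<le> size {#u \<in># M. v \<le> u#} + d"
  shows "\<exists>y. packs B y N \<and> (\<forall>j<B. load B y j \<le> load B x j + d)"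
  using assms
proof (induction "size N" arbitrary: N M x d)
  case 0
  then show ?case by (auto intro!: exI[of _ "\<lambda>i j. 0"])
next
  case (Suc n)
  then have "N \<noteq> {#}" by auto
  define m where "m = Max (set_mset N)"
  have m: "m \<in># N" "\<And>v. v \<in># N \<Longrightarrow> v \<le> m"
    using \<open>N \<noteq> {#}\<close> by (auto simp: m_def)
  obtain N' where N: "N = add_mset m N'" using m(1) by (metis insert_DiffM)
  have mB: "m \<in> {1..B}" using m(1) Suc.prems(3) by auto
  have sz: "size {#u \<in># N. v \<le> u#} = Suc (size {#u \<in># N'. v \<le> u#})" if "v \<in># N" for v
    using m(2)[OF that] by (simp add: N)
  show ?case
  proof (cases "\<exists>m'\<in>#M. m \<le> m'")
    case True
    then obtain m' M' where M: "M = add_mset m' M'" and mm: "m \<le> m'" by (metis insert_DiffM)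
    have m'B: "m' \<in> {1..B}" using M Suc.prems(2) by auto
    obtain a x' where a: "a + m' \<le> B" and x: "x = arcs_add x' (unit_arc a (a + m'))" and x': "packs B x' M'"
      using packs_remove_item[of B x m' M'] Suc.prems(1) M m'B by metis
    have "\<forall>v\<in>#N'. size {#u \<in># N'. v \<le> u#} \<le> size {#u \<in># M'. v \<le> u#} + d"
    proof
      fix v assume v: "v \<in># N'"
      then have "v \<le> m'" using m(2)[of v] mm N by auto
      then show "size {#u \<in># N'. v \<le> u#} \<le> size {#u \<in># M'. v \<le> u#} + d"
        using Suc.prems(4)[rule_format, of v] sz[of v] v by (auto simp: M N)
    qed
    then obtain y where y: "packs B y N'" "\<forall>j<B. load B y j \<le> load B x' j + d"
      using Suc.hyps(1)[of N' x' M' d] Suc.hyps(2) x' Suc.prems(2,3) M N by auto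
    have "packs B (arcs_add y (unit_arc a (a + m))) N"
      using packs_arcs_add[OF y(1) packs_unit_arc[of a m B]] a mm N by simp
    moreover have "load B (arcs_add y (unit_arc a (a + m))) j \<le> load B x j + d" if "j < B" for j
      using y(2)[rule_format, OF that] a mm by (simp add: x load_arcs_add load_unit_arc)
    ultimately show ?thesis by blast
  next
    case False
    then have "size {#u \<in># M. m \<le> u#} = 0" unfolding size_eq_0_iff_empty set_mset_eq_empty_iff[symmetric] by auto
    then have "d \<ge> 1" using Suc.prems(4)[rule_format, OF m(1)] sz[OF m(1)] by linarith
    have "\<forall>v\<in>#N'. size {#u \<in># N'. v \<le> u#} \<le> size {#u \<in># M. v \<le> u#} + (d - 1)"
    proof
      fix v assume v: "v \<in># N'"
      then show "size {#u \<in># N'. v \<le> u#} \<le> size {#u \<in># M. v \<le> u#} + (d - 1)"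
        using Suc.prems(4)[rule_format, of v] sz[of v] \<open>d \<ge> 1\<close> by (auto simp: N)
    qed
    then obtain y where y: "packs B y N'" "\<forall>j<B. load B y j \<le> load B x j + (d - 1)"
      using Suc.hyps(1)[of N' x M "d - 1"] Suc.hyps(2) Suc.prems(1,2,3) N by auto
    have "packs B (arcs_add y (unit_arc 0 (0 + m))) N"
      using packs_arcs_add[OF y(1) packs_unit_arc[of 0 m B]] mB N by simp
    moreover have "load B (arcs_add y (unit_arc 0 (0 + m))) j \<le> load B x j + d" if "j < B" for j
      using y(2)[rule_format, OF that] mB \<open>d \<ge> 1\<close> by (auto simp: load_arcs_add load_unit_arc of_bool_def)
    ultimately show ?thesis by blast
  qed
qed

section \<open>Packings as flows\<close>

text \<open>Items are moved one at a time from the first part to the second, each with an arc of its length;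
  no arc changes position, so loads are conserved.\<close>

lemma packs_split:
  assumes "packs B x (M + N)" "set_mset N \<subseteq> {1..B}"
  shows "\<exists>y y'. packs B y M \<and> packs B y' N \<and> (\<forall>j. load B y j + load B y' j = load B x j)"
  using assms
proof (induction N arbitrary: M)
  case empty
  then show ?case by (intro exI[of _ x] exI[of _ "\<lambda>i j. 0"]) auto
next
  case (add s N)
  obtain y y' where y: "packs B y (add_mset s M)" "packs B y' N" "\<forall>j. load B y j + load B y' j = load B x j"
    using add.IH[of "add_mset s M"] add.prems by auto
  obtain a z where a: "a + s \<le> B" "y = arcs_add z (unit_arc a (a + s))" "packs B z M"
    using packs_remove_item[OF y(1)] add.prems by auto
  have "packs B (arcs_add y' (unit_arc a (a + s))) (add_mset s N)"
    using packs_arcs_add[OF y(2) packs_unit_arc[OF a(1)]] by simp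
  moreover have "load B z j + load B (arcs_add y' (unit_arc a (a + s))) j = load B x j" for j
    using y(3)[rule_format, of j] by (simp add: a(2) load_arcs_add)
  ultimately show ?case using a(3) by blast
qed

lemma packs_split_sum:
  assumes "packs B x (\<Sum>u=1..T::nat. M u)" "\<And>u. u \<in> {1..T} \<Longrightarrow> set_mset (M u) \<subseteq> {1..B}"
  shows "\<exists>f. (\<forall>u\<in>{1..T}. packs B (f u) (M u)) \<and> (\<forall>j. (\<Sum>u=1..T. load B (f u) j) \<le> load B x j)"
  using assms
proof (induction T arbitrary: x)
  case 0
  show ?case by (rule exI[of _ "\<lambda>_ _ _. 0"]) simp
next
  case (Suc T)
  have MS: "set_mset (M (Suc T)) \<subseteq> {1..B}" using Suc.prems(2)[of "Suc T"] by simp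
  have "packs B x ((\<Sum>u=1..T. M u) + M (Suc T))" using Suc.prems(1) by simp
  from packs_split[OF this MS] obtain y y' where y: "packs B y (\<Sum>u=1..T. M u)" "packs B y' (M (Suc T))"
      "\<forall>j. load B y j + load B y' j = load B x j"
    by blast
  obtain f where f: "\<forall>u\<in>{1..T}. packs B (f u) (M u)" "\<forall>j. (\<Sum>u=1..T. load B (f u) j) \<le> load B y j"
    using Suc.IH[OF y(1)] Suc.prems(2) by (metis atLeastAtMost_iff le_SucI)
  have "(\<Sum>u=1..Suc T. load B ((f(Suc T := y')) u) j) \<le> load B x j" for j
  proof -
    have "(\<Sum>u=1..T. load B ((f(Suc T := y')) u) j) = (\<Sum>u=1..T. load B (f u) j)"
      by (intro sum.cong) auto
    then show ?thesis using f(2)[rule_format, of j] y(3)[rule_format, of j] by simp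
  qed
  then show ?case using f(1) y(2)
    by (intro exI[of _ "f(Suc T := y')"]) (auto simp: le_Suc_eq)
qed

text \<open>The items of a bin are laid out contiguously from position 0.\<close>

lemma packs_bin:
  assumes "sum_mset b \<le> B"
  shows "\<exists>x. packs B x b \<and> (\<forall>j. load B x j \<le> of_bool (j < sum_mset b))"
  using assms
proof (induction b)
  case empty
  then show ?case by (auto intro!: exI[of _ "\<lambda>i j. 0"])
next
  case (add s b)
  then obtain x where x: "packs B x b" "\<forall>j. load B x j \<le> of_bool (j < sum_mset b)" by auto
  let ?e = "unit_arc (sum_mset b) (sum_mset b + s)"
  have le: "sum_mset b + s \<le> B" using add.prems by simp
  have "load B (arcs_add x ?e) j \<le> of_bool (j < sum_mset (add_mset s b))" for j
    using x(2)[rule_format, of j] le by (auto simp: load_arcs_add load_unit_arc)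
  then show ?case using packs_arcs_add[OF x(1) packs_unit_arc[OF le]]
    by (intro exI[of _ "arcs_add x ?e"]) auto
qed

lemma packs_bins:
  assumes "\<forall>b\<in>#P. sum_mset b \<le> B"
  shows "\<exists>x. packs B x (sum_mset P) \<and> (\<forall>j. load B x j \<le> size P)"
  using assms
proof (induction P)
  case empty
  then show ?case by (auto intro!: exI[of _ "\<lambda>i j. 0"])
next
  case (add b P)
  then obtain x where x: "packs B x (sum_mset P)" "\<forall>j. load B x j \<le> size P" by auto
  obtain y where y: "packs B y b" "\<forall>j. load B y j \<le> of_bool (j < sum_mset b)"
    using packs_bin[of b B] add.prems by auto
  have "load B (arcs_add y x) j \<le> size (add_mset b P)" for j
    using x(2)[rule_format, of j] y(2)[rule_format, of j] by (auto simp: load_arcs_add of_bool_def split: if_splits)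
  then show ?case using packs_arcs_add[OF y(1) x(1)]
    by (intro exI[of _ "arcs_add y x"]) auto
qed

lemma opt_bins_packs:
  assumes "set_mset M \<subseteq> {1..B}"
  shows "\<exists>x. packs B x M \<and> (\<forall>j. load B x j \<le> opt_bins B M)"
proof -
  have "\<exists>P. size P = size M \<and> sum_mset P = M \<and> (\<forall>b\<in>#P. sum_mset b \<le> B)"
    using assms by (intro exI[of _ "image_mset (\<lambda>a. {#a#}) M"]) auto
  then have "\<exists>k. \<exists>P :: nat multiset multiset. size P = k \<and> sum_mset P = M \<and> (\<forall>b\<in>#P. sum_mset b \<le> B)"
    by blast
  from LeastI_ex[OF this] obtain P where "size P = opt_bins B M" "sum_mset P = M" "\<forall>b\<in>#P. sum_mset b \<le> B"
    unfolding opt_bins_def by blast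
  then show ?thesis using packs_bins[of P B] by auto
qed

section \<open>The excess of one batch over another\<close>

text \<open>Truncated subtraction and the inserted 0 make this the positive part of the largest difference of
  threshold counts. It suffices to range over the sizes in \<open>N\<close>: raising a threshold to the next such size
  keeps the count in \<open>N\<close> and does not increase the count in \<open>M\<close>.\<close>

definition excess :: "nat multiset \<Rightarrow> nat multiset \<Rightarrow> nat" where
  "excess N M = Max (insert 0 ((\<lambda>v. size {#u \<in># N. v \<le> u#} - size {#u \<in># M. v \<le> u#}) ` set_mset N))"

lemma excess_upper:
  assumes "v \<in># N"
  shows "size {#u \<in># N. v \<le> u#} \<le> size {#u \<in># M. v \<le> u#} + excess N M"
proof -
  have "size {#u \<in># N. v \<le> u#} - size {#u \<in># M. v \<le> u#} \<le> excess N M"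
    unfolding excess_def using assms by (intro Max_ge) auto
  then show ?thesis by simp
qed

lemma excess_attained:
  "excess N M = 0 \<or> (\<exists>v\<in>#N. excess N M = size {#u \<in># N. v \<le> u#} - size {#u \<in># M. v \<le> u#})"
proof -
  have "excess N M \<in> insert 0 ((\<lambda>v. size {#u \<in># N. v \<le> u#} - size {#u \<in># M. v \<le> u#}) ` set_mset N)"
    unfolding excess_def by (intro Max_in) auto
  then show ?thesis by auto
qed

section \<open>The programs of successive periods\<close>

definition batch :: "nat \<Rightarrow> sizes \<Rightarrow> nat \<Rightarrow> nat multiset" where
  "batch q V u = image_mset (\<lambda>i. V (u, i)) (mset_set {1..q})"

lemma batches_batch: "batches q V a b = (\<Sum>u=a..b. batch q V u)"
  by (simp add: batches_def batch_def)

lemma batches_cong: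
  "(\<And>u i. a \<le> u \<Longrightarrow> u \<le> b \<Longrightarrow> 1 \<le> i \<Longrightarrow> i \<le> q \<Longrightarrow> V (u, i) = W (u, i)) \<Longrightarrow> batches q V a b = batches q W a b"
  unfolding batches_def by (intro sum.cong image_mset_cong) auto

lemma oso_feasible_iff:
  assumes "B \<ge> 1"
  shows "p \<in> oso_feasible B q T t V W xb zb \<longleftrightarrow> (\<forall>\<tau>\<in>{t..T}.
     (\<forall>j<B. load B xb j + (\<Sum>u=t..\<tau>. load B (fst (p u)) j) \<le> zb + (\<Sum>u=t..\<tau>. snd (p u))) \<and>
     (\<forall>s\<in>{1..B}. placed B xb s + (\<Sum>u=t..\<tau>. placed B (fst (p u)) s)
        = count (batches q V 1 t + batches q W (t + 1) \<tau>) s))"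
proof -
  have l: "load B (\<lambda>i j. xb i j + (\<Sum>u=t..\<tau>. fst (p u) i j)) j = load B xb j + (\<Sum>u=t..\<tau>. load B (fst (p u)) j)" for \<tau> j
    unfolding load_def by (simp add: sum.distrib sum.swap[of _ "{t..\<tau>}"])
  have c: "placed B (\<lambda>i j. xb i j + (\<Sum>u=t..\<tau>. fst (p u) i j)) s = placed B xb s + (\<Sum>u=t..\<tau>. placed B (fst (p u)) s)" for \<tau> s
    unfolding placed_def by (simp add: sum.distrib sum.swap[of _ "{t..\<tau>}"])
  show ?thesis
    unfolding oso_feasible_def mem_Collect_eq flow_set_iff[OF assms] packs_def l c ..
qed

text \<open>All bins of an optimal packing of the first true batch and the later samples are opened in period 1.
  Every prefix of periods then uses a subset of its arcs, so no cell is overloaded.\<close>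

lemma oso_feasible_first:
  assumes "B \<ge> 1" "T \<ge> 1"
    and V: "set_mset (batch q V 1) \<subseteq> {1..B}" and W: "\<And>u. u \<in> {1..T} \<Longrightarrow> set_mset (batch q W u) \<subseteq> {1..B}"
  shows "\<exists>p\<in>oso_feasible B q T 1 V W (\<lambda>i j. 0) 0.
    oso_objective T 1 0 p = opt_bins B (batches q V 1 1 + batches q W 2 T)"
proof -
  define M where "M u = (if u = 1 then batch q V u else batch q W u)" for u
  define K where "K = opt_bins B (batches q V 1 1 + batches q W 2 T)"
  have split: "(\<Sum>u=1..\<tau>. M u) = batches q V 1 1 + batches q W 2 \<tau>" if "1 \<le> \<tau>" for \<tau>
  proof -
    have "{1..\<tau>} = insert 1 {2..\<tau>}" using that by auto
    moreover have "(\<Sum>u=2..\<tau>. M u) = (\<Sum>u=2..\<tau>. batch q W u)"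
      by (intro sum.cong) (auto simp: M_def)
    ultimately show ?thesis by (simp add: batches_batch M_def)
  qed
  have M: "set_mset (M u) \<subseteq> {1..B}" if "u \<in> {1..T}" for u
    using V W that by (auto simp: M_def)
  then have "set_mset (\<Sum>u=1..T. M u) \<subseteq> {1..B}" by (simp add: set_mset_sum UN_subset_iff)
  then obtain x where x: "packs B x (\<Sum>u=1..T. M u)" "\<forall>j. load B x j \<le> K"
    using opt_bins_packs[of "\<Sum>u=1..T. M u" B] unfolding K_def split[OF \<open>T \<ge> 1\<close>, symmetric] by blast
  obtain f where f: "\<forall>u\<in>{1..T}. packs B (f u) (M u)" "\<forall>j. (\<Sum>u=1..T. load B (f u) j) \<le> load B x j"
    using packs_split_sum[OF x(1) M] by auto
  define p :: plan where "p u = (f u, if u = 1 then K else 0)" for u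
  have z: "(\<Sum>u=1..\<tau>. snd (p u)) = K" if "1 \<le> \<tau>" for \<tau>
    using that by (simp add: p_def)
  have "p \<in> oso_feasible B q T 1 V W (\<lambda>i j. 0) 0"
    unfolding oso_feasible_iff[OF \<open>B \<ge> 1\<close>]
  proof (intro ballI conjI allI impI)
    fix \<tau> j assume \<tau>: "\<tau> \<in> {1..T}"
    have "(\<Sum>u=1..\<tau>. load B (fst (p u)) j) \<le> (\<Sum>u=1..T. load B (f u) j)"
      unfolding p_def fst_conv using \<tau> by (intro sum_mono2) auto
    also have "\<dots> \<le> K" using f(2) x(2) le_trans by blast
    finally show "load B (\<lambda>i j. 0) j + (\<Sum>u=1..\<tau>. load B (fst (p u)) j) \<le> 0 + (\<Sum>u=1..\<tau>. snd (p u))"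
      using z \<tau> by simp
  next
    fix \<tau> s assume \<tau>: "\<tau> \<in> {1..T}" and s: "s \<in> {1..B}"
    have "(\<Sum>u=1..\<tau>. placed B (fst (p u)) s) = (\<Sum>u=1..\<tau>. count (M u) s)"
      using f(1) \<tau> s by (intro sum.cong) (auto simp: p_def packs_def)
    also have "\<dots> = count (batches q V 1 1 + batches q W (1 + 1) \<tau>) s"
      using split[of \<tau>] \<tau> by (simp add: count_sum[symmetric] del: count_union One_nat_def)
    finally show "placed B (\<lambda>i j. 0) s + (\<Sum>u=1..\<tau>. placed B (fst (p u)) s)
        = count (batches q V 1 1 + batches q W (1 + 1) \<tau>) s"
      by (simp add: placed_def)
  qed
  moreover have "oso_objective T 1 0 p = K"
    using z[OF \<open>T \<ge> 1\<close>] by (simp add: oso_objective_def)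
  ultimately show ?thesis unfolding K_def by blast
qed

text \<open>Feasibility at \<open>t\<close> and at \<open>t + 1\<close> forces the part of the old plan for period \<open>t + 1\<close> to place exactly
  the sampled batch. Only this part is changed, by replacing the sampled items with the true ones; the
  extra bins are opened in the same period, so they cover the additional load in every later constraint.\<close>

lemma oso_feasible_next:
  assumes "B \<ge> 1" "1 \<le> t" "t < T"
    and V: "set_mset (batch q V (Suc t)) \<subseteq> {1..B}" and W: "set_mset (batch q W (Suc t)) \<subseteq> {1..B}"
    and p: "p \<in> oso_feasible B q T t V W xb zb"
  shows "\<exists>p'\<in>oso_feasible B q T (Suc t) V W (arcs_add xb (fst (p t))) (zb + snd (p t)).
    oso_objective T (Suc t) (zb + snd (p t)) p'
      = oso_objective T t zb p + excess (batch q V (Suc t)) (batch q W (Suc t))"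
proof -
  define d where "d = excess (batch q V (Suc t)) (batch q W (Suc t))"
  note p = p[unfolded oso_feasible_iff[OF \<open>B \<ge> 1\<close>]]
  have Wsplit: "batches q W (t + 1) \<tau> = batch q W (Suc t) + batches q W (Suc t + 1) \<tau>" if "Suc t \<le> \<tau>" for \<tau>
    unfolding batches_batch using that by (simp add: sum.atLeast_Suc_atMost)
  have Vsplit: "batches q V 1 (Suc t) = batches q V 1 t + batch q V (Suc t)"
    unfolding batches_batch by simp
  have tsplit: "(\<Sum>u=t..\<tau>. g u) = g t + (\<Sum>u=Suc t..\<tau>. g u)" if "Suc t \<le> \<tau>" for \<tau> and g :: "nat \<Rightarrow> nat"
    using that by (simp add: sum.atLeast_Suc_atMost)
  have tsplit': "(\<Sum>u=Suc t..\<tau>. g u) = g (Suc t) + (\<Sum>u=Suc (Suc t)..\<tau>. g u)" if "Suc t \<le> \<tau>" for \<tau> and g :: "nat \<Rightarrow> nat"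
    using that by (simp add: sum.atLeast_Suc_atMost)
  have "packs B (fst (p (Suc t))) (batch q W (Suc t))"
    unfolding packs_def
  proof
    fix s assume s: "s \<in> {1..B}"
    have "placed B xb s + placed B (fst (p t)) s = count (batches q V 1 t) s"
      using p[THEN bspec, of t] s assms(3) by (auto simp: batches_batch)
    moreover have "placed B xb s + (placed B (fst (p t)) s + placed B (fst (p (Suc t))) s)
        = count (batches q V 1 t) s + count (batch q W (Suc t)) s"
      using p[THEN bspec, of "Suc t"] s assms(3) by (auto simp: batches_batch)
    ultimately show "placed B (fst (p (Suc t))) s = count (batch q W (Suc t)) s" by simp
  qed
  then obtain y where y: "packs B y (batch q V (Suc t))" "\<forall>j<B. load B y j \<le> load B (fst (p (Suc t))) j + d"
    using packs_replace_items[OF _ W V] excess_upper unfolding d_def by blast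
  define p' where "p' = p(Suc t := (y, snd (p (Suc t)) + d))"
  have tail: "(\<Sum>u=Suc (Suc t)..\<tau>. g (p' u)) = (\<Sum>u=Suc (Suc t)..\<tau>. g (p u))" for \<tau> and g :: "arcs \<times> nat \<Rightarrow> nat"
    unfolding p'_def by (intro sum.cong) auto
  have "p' \<in> oso_feasible B q T (Suc t) V W (arcs_add xb (fst (p t))) (zb + snd (p t))"
    unfolding oso_feasible_iff[OF \<open>B \<ge> 1\<close>]
  proof (intro ballI conjI allI impI)
    fix \<tau> j assume \<tau>: "\<tau> \<in> {Suc t..T}" and j: "j < B"
    have "load B xb j + (\<Sum>u=t..\<tau>. load B (fst (p u)) j) \<le> zb + (\<Sum>u=t..\<tau>. snd (p u))"
      using p \<tau> j by auto
    then show "load B (arcs_add xb (fst (p t))) j + (\<Sum>u=Suc t..\<tau>. load B (fst (p' u)) j)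
        \<le> zb + snd (p t) + (\<Sum>u=Suc t..\<tau>. snd (p' u))"
      using \<tau> y(2)[rule_format, OF j] tail[of "\<lambda>a. load B (fst a) j" \<tau>] tail[of snd \<tau>]
      by (simp add: tsplit tsplit' load_arcs_add) (simp add: p'_def)
  next
    fix \<tau> s assume \<tau>: "\<tau> \<in> {Suc t..T}" and s: "s \<in> {1..B}"
    have "placed B xb s + (\<Sum>u=t..\<tau>. placed B (fst (p u)) s)
        = count (batches q V 1 t + batches q W (t + 1) \<tau>) s"
      using p \<tau> s by auto
    moreover have "placed B y s = count (batch q V (Suc t)) s" "placed B (fst (p (Suc t))) s = count (batch q W (Suc t)) s"
      using y(1) \<open>packs B (fst (p (Suc t))) (batch q W (Suc t))\<close> s by (auto simp: packs_def)
    ultimately show "placed B (arcs_add xb (fst (p t))) s + (\<Sum>u=Suc t..\<tau>. placed B (fst (p' u)) s)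
        = count (batches q V 1 (Suc t) + batches q W (Suc t + 1) \<tau>) s"
      using \<tau> tail[of "\<lambda>a. placed B (fst a) s" \<tau>]
        Vsplit Wsplit[of \<tau>]
      by (simp add: tsplit tsplit' placed_arcs_add p'_def)
  qed
  moreover have "oso_objective T (Suc t) (zb + snd (p t)) p' = oso_objective T t zb p + d"
    using assms(3) tail[of snd T] by (simp add: oso_objective_def tsplit tsplit') (simp add: p'_def)
  ultimately show ?thesis unfolding d_def by blast
qed

lemma oso_feasible_observed: "oso_feasible B q T t (observed t V) W xb zb = oso_feasible B q T t V W xb zb"
proof -
  have "batches q (observed t V) 1 t = batches q V 1 t"
    by (intro batches_cong) (simp add: observed_def)
  then show ?thesis by (simp add: oso_feasible_def)
qed

text \<open>Telescoping of the optimal values. The plan inherited from the previous period is a feasible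
  competitor, so no optimal solution exceeds its value, whatever the tie-breaking; it also
  guarantees that each program is feasible.\<close>

lemma oso_cost_le:
  assumes "B \<ge> 1" "T \<ge> 1" and slv: "optimal_solver B q T slv"
    and V: "\<And>u. u \<in> {1..T} \<Longrightarrow> set_mset (batch q V u) \<subseteq> {1..B}"
    and W: "\<And>u. u \<in> {1..T} \<Longrightarrow> set_mset (batch q W u) \<subseteq> {1..B}"
  shows "oso_cost slv T V W \<le> opt_bins B (batches q V 1 1 + batches q W 2 T)
    + (\<Sum>u=2..T. excess (batch q V u) (batch q W u))"
proof -
  \<comment> \<open>\<open>P t\<close> is the plan computed in period \<open>t + 1\<close> from the decisions of the first \<open>t\<close> periods.\<close>
  define X Z P where "X t = fst (oso_state slv V W t)" and "Z t = snd (oso_state slv V W t)"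
    and "P t = slv (Suc t) (observed (Suc t) V) W (X t) (Z t)" for t
  have XS: "X (Suc t) = arcs_add (X t) (fst (P t (Suc t)))" and ZS: "Z (Suc t) = Z t + snd (P t (Suc t))" for t
    by (simp_all add: X_def Z_def P_def arcs_add_def split: prod.splits)
  have opt: "P t \<in> oso_feasible B q T (Suc t) V W (X t) (Z t) \<and>
      oso_objective T (Suc t) (Z t) (P t) \<le> oso_objective T (Suc t) (Z t) p"
    if "p \<in> oso_feasible B q T (Suc t) V W (X t) (Z t)" "t < T" for t p
  proof -
    have "is_arg_min (oso_objective T (Suc t) (Z t)) (\<lambda>p. p \<in> oso_feasible B q T (Suc t) (observed (Suc t) V) W (X t) (Z t)) (P t)"
      using slv[unfolded optimal_solver_def, rule_format, of "Suc t" "observed (Suc t) V" W "X t" "Z t"] that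
      unfolding P_def oso_feasible_observed by auto
    then show ?thesis using that unfolding oso_feasible_observed is_arg_min_linorder by auto
  qed
  have "t < T \<longrightarrow> P t \<in> oso_feasible B q T (Suc t) V W (X t) (Z t) \<and>
      oso_objective T (Suc t) (Z t) (P t) \<le> opt_bins B (batches q V 1 1 + batches q W 2 T)
        + (\<Sum>u=2..Suc t. excess (batch q V u) (batch q W u))" for t
  proof (induction t)
    case 0
    have "X 0 = (\<lambda>i j. 0)" "Z 0 = 0" by (simp_all add: X_def Z_def)
    then show ?case using oso_feasible_first[OF assms(1,2) V W] opt[of _ 0] \<open>T \<ge> 1\<close> by fastforce
  next
    case (Suc t)
    show ?case
    proof
      assume t: "Suc t < T"
      obtain p where p: "p \<in> oso_feasible B q T (Suc (Suc t)) V W (X (Suc t)) (Z (Suc t))"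
        "oso_objective T (Suc (Suc t)) (Z (Suc t)) p = oso_objective T (Suc t) (Z t) (P t) +
          excess (batch q V (Suc (Suc t))) (batch q W (Suc (Suc t)))"
        unfolding XS ZS
        using oso_feasible_next[OF \<open>B \<ge> 1\<close> _ t V W, of "P t" "X t" "Z t"] Suc.IH t by auto
      show "P (Suc t) \<in> oso_feasible B q T (Suc (Suc t)) V W (X (Suc t)) (Z (Suc t)) \<and>
        oso_objective T (Suc (Suc t)) (Z (Suc t)) (P (Suc t)) \<le> opt_bins B (batches q V 1 1 + batches q W 2 T)
        + (\<Sum>u=2..Suc (Suc t). excess (batch q V u) (batch q W u))"
        using opt[OF p(1) t] p(2) Suc.IH t by auto
    qed
  qed
  from this[of "T - 1"] \<open>T \<ge> 1\<close> have "oso_objective T T (Z (T - 1)) (P (T - 1)) \<le>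
      opt_bins B (batches q V 1 1 + batches q W 2 T) + (\<Sum>u=2..T. excess (batch q V u) (batch q W u))"
    by auto
  moreover have "oso_cost slv T V W = oso_objective T T (Z (T - 1)) (P (T - 1))"
    using ZS[of "T - 1"] \<open>T \<ge> 1\<close> by (simp add: oso_cost_def oso_objective_def Z_def)
  ultimately show ?thesis by simp
qed


section \<open>Expected excess of two independent samples\<close>

lemma expectation_pair_pmf_mult:
  fixes f :: "'a \<Rightarrow> real" and g :: "'b \<Rightarrow> real"
  assumes "finite (set_pmf p)" "finite (set_pmf r)"
  shows "measure_pmf.expectation (pair_pmf p r) (\<lambda>(a, b). f a * g b)
    = measure_pmf.expectation p f * measure_pmf.expectation r g"
proof -
  have "measure_pmf.expectation (pair_pmf p r) (\<lambda>(a, b). f a * g b)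
      = (\<Sum>(a, b)\<in>set_pmf p \<times> set_pmf r. (f a * pmf p a) * (g b * pmf r b))"
    by (subst integral_measure_pmf_real[of "set_pmf p \<times> set_pmf r"])
      (use assms in \<open>auto simp: pmf_pair mult_ac intro!: sum.cong\<close>)
  also have "\<dots> = (\<Sum>a\<in>set_pmf p. f a * pmf p a) * (\<Sum>b\<in>set_pmf r. g b * pmf r b)"
    by (simp add: sum_product sum.cartesian_product)
  also have "\<dots> = measure_pmf.expectation p f * measure_pmf.expectation r g"
    using assms by (simp add: integral_measure_pmf_real[of "set_pmf p"] integral_measure_pmf_real[of "set_pmf r"])
  finally show ?thesis .
qed

lemma expectation_Pi_pmf_prod_subset:
  fixes g :: "'i \<Rightarrow> 'a \<Rightarrow> real"
  assumes "finite I" "J \<subseteq> I" "finite (set_pmf D)" "\<And>l x. g l x \<ge> 0"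
  shows "measure_pmf.expectation (Pi_pmf I dflt (\<lambda>_. D)) (\<lambda>V. \<Prod>l\<in>J. g l (V l))
    = (\<Prod>l\<in>J. measure_pmf.expectation D (g l))"
proof -
  define h where "h l = (if l \<in> J then g l else (\<lambda>_. 1))" for l
  have restr: "(\<Prod>l\<in>J. F l) = (\<Prod>l\<in>I. if l \<in> J then F l else 1)" for F :: "'i \<Rightarrow> real"
    using assms(1,2) by (simp add: prod.inter_restrict[symmetric] Int_absorb1)
  have "measure_pmf.expectation (Pi_pmf I dflt (\<lambda>_. D)) (\<lambda>V. \<Prod>l\<in>J. g l (V l))
      = measure_pmf.expectation (Pi_pmf I dflt (\<lambda>_. D)) (\<lambda>V. \<Prod>l\<in>I. h l (V l))"
    unfolding restr by (intro Bochner_Integration.integral_cong refl prod.cong) (simp add: h_def)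
  also have "\<dots> = (\<Prod>l\<in>I. measure_pmf.expectation D (h l))"
    using assms by (intro expectation_prod_Pi_pmf) (auto simp: h_def intro: integrable_measure_pmf_finite)
  also have "\<dots> = (\<Prod>l\<in>J. measure_pmf.expectation D (g l))"
    unfolding restr by (intro prod.cong refl) (simp add: h_def)
  finally show ?thesis .
qed

lemma expectation_exp_indicator:
  fixes D :: "nat pmf"
  assumes "finite (set_pmf D)"
  shows "measure_pmf.expectation D (\<lambda>x. exp (\<theta> * of_bool (v \<le> x)))
    = 1 + measure_pmf.prob D {v..} * (exp \<theta> - 1)"
proof -
  have "(\<lambda>x. exp (\<theta> * of_bool (v \<le> x))) = (\<lambda>x. 1 + indicator {v..} x * (exp \<theta> - 1))"
    by (auto simp: fun_eq_iff)
  then show ?thesis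
    using assms by (simp add: integrable_measure_pmf_finite)
qed

text \<open>The difference of two independent Bernoulli variables with the same parameter is centred and lies in
  \<open>[-1, 1]\<close>, so it is sub-Gaussian. In this case the product of the moment generating functions is
  explicit, and \<open>p * (1 - p) \<le> 1 / 4\<close> gives the variance proxy 1.\<close>

lemma bernoulli_mgf_product_le:
  fixes p \<theta> :: real
  assumes "0 \<le> p" "p \<le> 1" "0 \<le> \<theta>" "\<theta> \<le> 1"
  shows "(1 + p * (exp \<theta> - 1)) * (1 + p * (exp (- \<theta>) - 1)) \<le> exp (\<theta>\<^sup>2 / 2)"
proof -
  have e: "exp \<theta> * exp (- \<theta>) = 1" by (simp add: exp_minus)
  have "(1 + p * (exp \<theta> - 1)) * (1 + p * (exp (- \<theta>) - 1))
      = 1 + p * (exp \<theta> + exp (- \<theta>) - 2) + p * p * (exp \<theta> * exp (- \<theta>) + 1 - exp \<theta> - exp (- \<theta>))"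
    by (simp add: algebra_simps)
  also have "\<dots> = 1 + p * (1 - p) * (exp \<theta> + exp (- \<theta>) - 2)"
    unfolding e by (simp add: algebra_simps)
  also have "\<dots> \<le> 1 + (1 / 4) * (2 * \<theta>\<^sup>2)"
  proof -
    have "exp \<theta> \<le> 1 + \<theta> + \<theta>\<^sup>2" using assms by (intro exp_bound) auto
    moreover have "exp (- \<theta>) \<le> 1 - \<theta> + \<theta>\<^sup>2"
    proof -
      have "exp (- \<theta>) \<le> 1 / (1 + \<theta>)"
        using assms exp_ge_add_one_self[of \<theta>] by (simp add: exp_minus inverse_eq_divide divide_left_mono)
      also have "\<dots> \<le> 1 - \<theta> + \<theta>\<^sup>2"
      proof -
        have "(1 - \<theta> + \<theta>\<^sup>2) * (1 + \<theta>) = 1 + \<theta> ^ 3"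
          by (simp add: algebra_simps power2_eq_square power3_eq_cube)
        moreover have "0 \<le> \<theta> ^ 3" using assms by simp
        ultimately have "1 \<le> (1 - \<theta> + \<theta>\<^sup>2) * (1 + \<theta>)" by linarith
        then show ?thesis using assms by (simp add: divide_le_eq)
      qed
      finally show ?thesis .
    qed
    ultimately have u: "exp \<theta> + exp (- \<theta>) - 2 \<le> 2 * \<theta>\<^sup>2" by linarith
    have "p * (1 - p) \<le> 1 / 4"
      using zero_le_power2[of "p - 1 / 2"] by (simp add: power2_eq_square algebra_simps)
    moreover have "0 \<le> p * (1 - p)" using assms by simp
    ultimately have "p * (1 - p) * (exp \<theta> + exp (- \<theta>) - 2) \<le> (1 / 4) * (2 * \<theta>\<^sup>2)"
      using u by (meson mult_left_mono mult_right_mono order_trans zero_le_mult_iff zero_le_power2 zero_le_numeral)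
    then show ?thesis by simp
  qed
  also have "\<dots> \<le> exp (\<theta>\<^sup>2 / 2)" using exp_ge_add_one_self[of "\<theta>\<^sup>2 / 2"] by simp
  finally show ?thesis .
qed

lemma size_filter_batch:
  "real (size {#u \<in># batch q V t. v \<le> u#}) = (\<Sum>l\<in>{t} \<times> {1..q}. of_bool (v \<le> V l))"
proof -
  have "{#u \<in># batch q V t. v \<le> u#} = image_mset (\<lambda>i. V (t, i)) (mset_set {i \<in> {1..q}. v \<le> V (t, i)})"
    by (simp add: batch_def filter_mset_image_mset)
  then have "size {#u \<in># batch q V t. v \<le> u#} = card {i \<in> {1..q}. v \<le> V (t, i)}" by simp
  also have "real \<dots> = (\<Sum>i\<in>{1..q}. of_bool (v \<le> V (t, i)))"
    by (simp add: of_bool_def sum.If_cases Int_def)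
  also have "\<dots> = (\<Sum>l\<in>{t} \<times> {1..q}. of_bool (v \<le> V l))"
    by (rule sum.reindex_bij_witness[of _ snd "Pair t"]) auto
  finally show ?thesis by simp
qed

text \<open>The maximum over thresholds is bounded by a sum. The random threshold \<open>V k\<close> is replaced by a sum over its
  possible values \<open>v\<close>, guarded by the indicator of \<open>V k = v\<close>: each summand is then a product of functions
  of single items, whose expectation factorises.\<close>

lemma exp_excess_le:
  fixes \<theta> :: real
  assumes "0 \<le> \<theta>" and V: "\<And>k. k \<in> {t} \<times> {1..q} \<Longrightarrow> V k \<in> {1..B}"
  shows "exp (\<theta> * real (excess (batch q V t) (batch q W t))) \<le>
    1 + (\<Sum>k\<in>{t} \<times> {1..q}. \<Sum>v\<in>{1..B}. of_bool (V k = v)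
          * (\<Prod>l\<in>{t} \<times> {1..q}. exp (\<theta> * of_bool (v \<le> V l)))
          * (\<Prod>l\<in>{t} \<times> {1..q}. exp (- \<theta> * of_bool (v \<le> W l))))"
    (is "_ \<le> 1 + (\<Sum>k\<in>?J. \<Sum>v\<in>?S. ?g k v)")
proof -
  have exp_J: "exp (\<theta> * (sum a ?J - sum b ?J)) = (\<Prod>l\<in>?J. exp (\<theta> * a l)) * (\<Prod>l\<in>?J. exp (- \<theta> * b l))"
    for a b :: "nat \<times> nat \<Rightarrow> real"
  proof -
    have "\<theta> * (sum a ?J - sum b ?J) = (\<Sum>l\<in>?J. \<theta> * a l) + (\<Sum>l\<in>?J. - \<theta> * b l)"
      unfolding sum_distrib_left[symmetric] by (simp add: algebra_simps)
    then show ?thesis by (simp add: exp_add exp_sum)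
  qed
  have pos: "0 \<le> ?g k v" for k v by (intro mult_nonneg_nonneg prod_nonneg) auto
  have g: "?g k v = of_bool (V k = v) * exp (\<theta> * (real (size {#u \<in># batch q V t. v \<le> u#}) - real (size {#u \<in># batch q W t. v \<le> u#})))" for k v
    unfolding size_filter_batch exp_J by (simp only: mult.assoc)
  show ?thesis
  proof (cases "excess (batch q V t) (batch q W t) = 0")
    case True
    then show ?thesis using pos by (simp add: sum_nonneg)
  next
    case False
    then obtain v where v: "v \<in># batch q V t"
      "excess (batch q V t) (batch q W t) = size {#u \<in># batch q V t. v \<le> u#} - size {#u \<in># batch q W t. v \<le> u#}"
      using excess_attained[of "batch q V t" "batch q W t"] by auto
    obtain i where i: "i \<in> {1..q}" "V (t, i) = v" using v(1) by (auto simp: batch_def)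
    have k: "(t, i) \<in> ?J" "v \<in> ?S" using i V[of "(t, i)"] by auto
    have "real (excess (batch q V t) (batch q W t))
        = real (size {#u \<in># batch q V t. v \<le> u#}) - real (size {#u \<in># batch q W t. v \<le> u#})"
      using v(2) False by (simp add: of_nat_diff)
    then have "exp (\<theta> * real (excess (batch q V t) (batch q W t))) = ?g (t, i) v"
      by (subst g) (simp add: i(2))
    also have "\<dots> \<le> (\<Sum>v\<in>?S. ?g (t, i) v)"
      by (rule member_le_sum[of v ?S "\<lambda>v. ?g (t, i) v"]) (use k pos in auto)
    also have "\<dots> \<le> (\<Sum>k\<in>?J. \<Sum>v\<in>?S. ?g k v)"
      by (rule member_le_sum[of "(t, i)" ?J "\<lambda>k. \<Sum>v\<in>?S. ?g k v"]) (use k pos in \<open>auto intro!: sum_nonneg\<close>)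
    finally show ?thesis by simp
  qed
qed

lemma set_iid_sizes:
  assumes "set_pmf D \<subseteq> {1..B}"
  shows "finite (set_pmf (iid_sizes T q D))"
    and "V \<in> set_pmf (iid_sizes T q D) \<Longrightarrow> k \<in> {1..T} \<times> {1..q} \<Longrightarrow> V k \<in> {1..B}"
proof -
  have *: "set_pmf (iid_sizes T q D) = PiE_dflt ({1..T} \<times> {1..q}) 0 (set_pmf \<circ> (\<lambda>_. D))"
    unfolding iid_sizes_def by (intro set_Pi_pmf) auto
  show "finite (set_pmf (iid_sizes T q D))"
    unfolding * using assms by (intro finite_PiE_dflt) (auto intro: finite_subset)
  show "V k \<in> {1..B}" if "V \<in> set_pmf (iid_sizes T q D)" "k \<in> {1..T} \<times> {1..q}"
  proof -
    have "V k \<in> set_pmf D" using that unfolding * PiE_dflt_def by (cases k) auto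
    then show ?thesis using assms by blast
  qed
qed

text \<open>For a fixed item \<open>k\<close> and threshold \<open>v\<close>, item \<open>k\<close> itself contributes \<open>exp \<theta>\<close> times the probability of size
  \<open>v\<close>; the other true items, paired with samples, contribute centred differences. As the
  probabilities of the \<open>v\<close> add up to 1, the union bound costs a factor \<open>q\<close> and does not depend on \<open>B\<close>.\<close>

lemma expectation_exp_excess_le:
  fixes \<theta> :: real
  assumes D: "set_pmf D \<subseteq> {1..B}" and t: "t \<in> {1..T}" and q: "q \<ge> 1" and \<theta>: "0 \<le> \<theta>" "\<theta> \<le> 1"
  shows "measure_pmf.expectation (pair_pmf (iid_sizes T q D) (iid_sizes T q D))
      (\<lambda>(V, W). exp (\<theta> * real (excess (batch q V t) (batch q W t))))
    \<le> 1 + real q * exp (\<theta> + \<theta>\<^sup>2 * real q / 2)"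
proof -
  define P where "P = iid_sizes T q D"
  define J where "J = {t} \<times> {1..q}"
  define f where "f k v V = of_bool (V k = v) * (\<Prod>l\<in>J. exp (\<theta> * of_bool (v \<le> V l)))" for k v and V :: sizes
  define g where "g v W = (\<Prod>l\<in>J. exp (- \<theta> * of_bool (v \<le> W l)))" for v and W :: sizes
  have finP: "finite (set_pmf P)" unfolding P_def by (rule set_iid_sizes(1)[OF D])
  have fin2: "finite (set_pmf (pair_pmf P P))" using finP by simp
  have finD: "finite (set_pmf D)" using D by (rule finite_subset) simp
  have J: "J \<subseteq> {1..T} \<times> {1..q}" "finite J" "card J = q" using t by (auto simp: J_def)
  have int: "integrable (measure_pmf (pair_pmf P P)) h" for h :: "sizes \<times> sizes \<Rightarrow> real"
    by (rule integrable_measure_pmf_finite[OF fin2])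
  have fg: "measure_pmf.expectation (pair_pmf P P) (\<lambda>(V, W). f k v V * g v W)
      \<le> pmf D v * exp (\<theta> + \<theta>\<^sup>2 * real q / 2)" if k: "k \<in> J" for k v
  proof -
    define p where "p = measure_pmf.prob D {v..}"
    define a b where "a = 1 + p * (exp \<theta> - 1)" and "b = 1 + p * (exp (- \<theta>) - 1)"
    have p: "0 \<le> p" "p \<le> 1" by (auto simp: p_def)
    have "f k v = (\<lambda>V. \<Prod>l\<in>J. (if l = k then of_bool (V l = v) else 1) * exp (\<theta> * of_bool (v \<le> V l)))"
      using k J(2) by (simp add: f_def fun_eq_iff prod.distrib prod.delta)
    then have "measure_pmf.expectation P (f k v)
        = (\<Prod>l\<in>J. measure_pmf.expectation D (\<lambda>x. (if l = k then of_bool (x = v) else 1) * exp (\<theta> * of_bool (v \<le> x))))"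
      unfolding P_def iid_sizes_def
      by (simp only:) (rule expectation_Pi_pmf_prod_subset, use J finD in auto)
    also have "\<dots> = measure_pmf.expectation D (\<lambda>x. of_bool (x = v) * exp (\<theta> * of_bool (v \<le> x)))
        * (\<Prod>l\<in>J - {k}. measure_pmf.expectation D (\<lambda>x. exp (\<theta> * of_bool (v \<le> x))))"
      using k J(2) by (subst prod.remove[of J k]) (auto intro!: prod.cong)
    also have "(\<Prod>l\<in>J - {k}. measure_pmf.expectation D (\<lambda>x. exp (\<theta> * of_bool (v \<le> x)))) = a ^ (q - 1)"
      unfolding expectation_exp_indicator[OF finD] using k J by (simp add: a_def p_def)
    also have "(\<lambda>x. of_bool (x = v) * exp (\<theta> * of_bool (v \<le> x))) = (\<lambda>x. indicator {v} x * exp \<theta>)"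
      by (auto simp: fun_eq_iff)
    also have "measure_pmf.expectation D (\<lambda>x. indicator {v} x * exp \<theta>) = pmf D v * exp \<theta>"
      by (simp add: measure_pmf_single)
    finally have Ef: "measure_pmf.expectation P (f k v) = pmf D v * exp \<theta> * a ^ (q - 1)" .
    have "measure_pmf.expectation P (g v) = (\<Prod>l\<in>J. measure_pmf.expectation D (\<lambda>x. exp (- \<theta> * of_bool (v \<le> x))))"
      unfolding P_def iid_sizes_def g_def
      by (rule expectation_Pi_pmf_prod_subset) (use J finD in auto)
    then have Eg: "measure_pmf.expectation P (g v) = b ^ q"
      unfolding expectation_exp_indicator[OF finD] using J by (simp add: b_def p_def)
    have b: "0 \<le> b" "b \<le> 1"
    proof -
      have "0 \<le> (1 - p) + p * exp (- \<theta>)" using p by simp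
      then show "0 \<le> b" by (simp add: b_def algebra_simps)
      have "p * (exp (- \<theta>) - 1) \<le> 0" using p \<theta> by (intro mult_nonneg_nonpos) auto
      then show "b \<le> 1" by (simp add: b_def)
    qed
    have a: "0 \<le> a" using p \<theta> by (simp add: a_def)
    have ab: "a * b \<le> exp (\<theta>\<^sup>2 / 2)" unfolding a_def b_def by (rule bernoulli_mgf_product_le[OF p \<theta>])
    \<comment> \<open>One sampled item has no partner, as the item that fixes the threshold is spent; its factor is at most 1.\<close>
    have "a ^ (q - 1) * b ^ q = (a * b) ^ (q - 1) * b"
      using q by (cases q) (auto simp: power_mult_distrib)
    also have "\<dots> \<le> (a * b) ^ (q - 1)" using a b by (intro mult_left_le) auto
    also have "\<dots> \<le> exp (\<theta>\<^sup>2 / 2) ^ (q - 1)" using ab a b by (intro power_mono) auto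
    also have "\<dots> \<le> exp (\<theta>\<^sup>2 / 2) ^ q" by (intro power_increasing) auto
    also have "\<dots> = exp (\<theta>\<^sup>2 * real q / 2)" by (simp add: exp_of_nat_mult[symmetric] mult_ac)
    finally have le: "a ^ (q - 1) * b ^ q \<le> exp (\<theta>\<^sup>2 * real q / 2)" .
    have "measure_pmf.expectation (pair_pmf P P) (\<lambda>(V, W). f k v V * g v W)
        = (pmf D v * exp \<theta>) * (a ^ (q - 1) * b ^ q)"
      by (simp add: expectation_pair_pmf_mult[OF finP finP] Ef Eg)
    also have "\<dots> \<le> (pmf D v * exp \<theta>) * exp (\<theta>\<^sup>2 * real q / 2)"
      by (intro mult_left_mono le) simp
    finally show ?thesis by (simp add: exp_add mult_ac)
  qed
  have "measure_pmf.expectation (pair_pmf P P) (\<lambda>(V, W). exp (\<theta> * real (excess (batch q V t) (batch q W t))))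
      \<le> measure_pmf.expectation (pair_pmf P P) (\<lambda>x. 1 + (\<Sum>k\<in>J. \<Sum>v\<in>{1..B}. (case x of (V, W) \<Rightarrow> f k v V * g v W)))"
  proof (intro integral_mono_AE int, unfold AE_measure_pmf_iff, safe)
    fix V W assume "(V, W) \<in> set_pmf (pair_pmf P P)"
    then have "V \<in> set_pmf P" by simp
    then have "V k \<in> {1..B}" if "k \<in> J" for k
      using set_iid_sizes(2)[OF D] J(1) that unfolding P_def by blast
    then show "exp (\<theta> * real (excess (batch q V t) (batch q W t)))
        \<le> 1 + (\<Sum>k\<in>J. \<Sum>v\<in>{1..B}. f k v V * g v W)"
      using exp_excess_le[OF \<theta>(1), of t q V B W] unfolding f_def g_def J_def by blast
  qed
  also have "\<dots> = 1 + (\<Sum>k\<in>J. \<Sum>v\<in>{1..B}. measure_pmf.expectation (pair_pmf P P) (\<lambda>(V, W). f k v V * g v W))"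
    by (simp add: int Bochner_Integration.integral_sum)
  also have "\<dots> \<le> 1 + (\<Sum>k\<in>J. \<Sum>v\<in>{1..B}. pmf D v * exp (\<theta> + \<theta>\<^sup>2 * real q / 2))"
    using fg by (intro add_left_mono sum_mono) auto
  also have "\<dots> = 1 + real q * exp (\<theta> + \<theta>\<^sup>2 * real q / 2)"
    using sum_pmf_eq_1[of "{1..B}" D] D J(3) by (simp add: sum_distrib_right[symmetric])
  finally show ?thesis unfolding P_def .
qed

lemma ln_2_ge_half: "1 / 2 \<le> ln (2 :: real)"
  by (rule ln_ge_iff[THEN iffD2, OF _ exp_half_le2]) simp

text \<open>The exponential moment bound is optimised at \<open>\<theta> = sqrt (ln q / q)\<close>, up to constants.\<close>

lemma expectation_excess_le:
  assumes D: "set_pmf D \<subseteq> {1..B}" and t: "t \<in> {1..T}" and q: "q \<ge> 2"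
  shows "measure_pmf.expectation (pair_pmf (iid_sizes T q D) (iid_sizes T q D))
      (\<lambda>(V, W). real (excess (batch q V t) (batch q W t)))
    \<le> 5 * sqrt (real q * ln (real q))"
proof -
  define P where "P = pair_pmf (iid_sizes T q D) (iid_sizes T q D)"
  define E where "E = measure_pmf.expectation P (\<lambda>(V, W). real (excess (batch q V t) (batch q W t)))"
  define L where "L = ln (real q)"
  define R where "R = sqrt (real q * L)"
  define \<theta> where "\<theta> = sqrt (L / real q)"
  define m where "m = 2 * real q * exp (\<theta> + \<theta>\<^sup>2 * real q / 2)"
  have "finite (set_pmf P)" unfolding P_def using set_iid_sizes(1)[OF D] by simp
  then have int: "integrable (measure_pmf P) h" for h :: "sizes \<times> sizes \<Rightarrow> real"
    by (rule integrable_measure_pmf_finite)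
  have L2: "ln 2 \<le> L" using q by (simp add: L_def)
  have L1: "1 / 2 \<le> L" using L2 ln_2_ge_half by linarith
  have Lq: "L \<le> real q" unfolding L_def using q ln_le_minus_one[of "real q"] by simp
  have \<theta>: "0 < \<theta>" "\<theta> \<le> 1" using L1 Lq q by (auto simp: \<theta>_def)
  have \<theta>R: "\<theta> * R = L" using q L1 by (simp add: \<theta>_def R_def real_sqrt_mult[symmetric] power2_eq_square[symmetric])
  have \<theta>2: "\<theta>\<^sup>2 * real q = L" using q L1 by (simp add: \<theta>_def)
  have m: "m > 0" using q by (simp add: m_def)
  have "1 * 1 \<le> real q * exp (\<theta> + \<theta>\<^sup>2 * real q / 2)"
    using q \<theta> by (intro mult_mono) auto
  then have "measure_pmf.expectation P (\<lambda>(V, W). exp (\<theta> * real (excess (batch q V t) (batch q W t)))) \<le> m"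
    using expectation_exp_excess_le[OF D t, of q \<theta>] q \<theta> unfolding P_def m_def by simp
  \<comment> \<open>Instead of Jensen's inequality: integrate the tangent of \<open>exp\<close> at \<open>ln m\<close>, which lies below \<open>exp\<close>.\<close>
  moreover have "measure_pmf.expectation P (\<lambda>x. m * (1 - ln m) + m * \<theta> * (case x of (V, W) \<Rightarrow> real (excess (batch q V t) (batch q W t))))
      \<le> measure_pmf.expectation P (\<lambda>(V, W). exp (\<theta> * real (excess (batch q V t) (batch q W t))))"
  proof (intro integral_mono int, safe)
    fix V W :: sizes
    define y where "y = \<theta> * real (excess (batch q V t) (batch q W t))"
    have "m * (1 + (y - ln m)) \<le> m * exp (y - ln m)"
      using m by (intro mult_left_mono) auto
    also have "\<dots> = exp y" using m by (simp add: exp_diff)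
    finally show "m * (1 - ln m) + m * \<theta> * real (excess (batch q V t) (batch q W t)) \<le> exp (\<theta> * real (excess (batch q V t) (batch q W t)))"
      by (simp add: y_def algebra_simps)
  qed
  moreover have "measure_pmf.expectation P (\<lambda>x. m * (1 - ln m) + m * \<theta> * (case x of (V, W) \<Rightarrow> real (excess (batch q V t) (batch q W t))))
      = m * (1 - ln m) + m * \<theta> * E"
    unfolding E_def by (subst Bochner_Integration.integral_add[OF int int]) simp
  ultimately have "m * (1 - ln m) + m * \<theta> * E \<le> m" by linarith
  then have "m * (\<theta> * E) \<le> m * ln m" by (simp add: right_diff_distrib)
  then have "\<theta> * E \<le> ln m" using m by (rule mult_left_le_imp_le)
  also have "ln m = ln (2 * real q) + (\<theta> + L / 2)"
    unfolding m_def \<theta>2 using q by (subst ln_mult) auto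
  also have "ln (2 * real q) = ln 2 + L"
    unfolding L_def using q by (subst ln_mult) auto
  also have "ln 2 + L + (\<theta> + L / 2) \<le> 5 / 2 * L + \<theta>" using L2 by linarith
  also have "\<dots> = \<theta> * (5 / 2 * R + 1)"
    unfolding \<theta>R[symmetric] by (simp only: ring_distribs mult_1_right mult_ac)
  finally have "E \<le> 5 / 2 * R + 1" using \<theta>(1) by (rule mult_left_le_imp_le)
  moreover have "1 \<le> R"
  proof -
    have "2 * (1 / 2) \<le> real q * L" using q L1 by (intro mult_mono) auto
    then show ?thesis by (simp add: R_def)
  qed
  ultimately show ?thesis unfolding E_def P_def R_def L_def by linarith
qed

section \<open>Expected cost\<close>

text \<open>The first batch of \<open>V\<close> and the later batches of \<open>W\<close> concern disjoint sets of items, so together they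
  are distributed like \<open>V\<close>.\<close>

lemma expectation_opt_bins_resampled:
  assumes "T \<ge> 1"
  shows "measure_pmf.expectation (pair_pmf (iid_sizes T q D) (iid_sizes T q D))
      (\<lambda>(V, W). f (batches q V 1 1 + batches q W 2 T))
    = measure_pmf.expectation (iid_sizes T q D) (\<lambda>V. f (batches q V 1 T) :: real)"
proof -
  define P where "P = iid_sizes T q D"
  define I J where "I = {1::nat} \<times> {1..q}" and "J = {2..T} \<times> {1..q}"
  define mix :: "sizes \<times> sizes \<Rightarrow> sizes" where
    "mix = (\<lambda>(V, W) k. if k \<in> I then V k else if k \<in> J then W k else 0)"
  have IJ: "{1..T} \<times> {1..q} = I \<union> J" "I \<inter> J = {}" "finite I" "finite J"
    using assms by (auto simp: I_def J_def)
  have sub: "Pi_pmf A 0 (\<lambda>_. D) = map_pmf (\<lambda>V k. if k \<in> A then V k else 0) P" if "A \<subseteq> I \<union> J" for A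
    unfolding P_def iid_sizes_def IJ(1) using IJ that by (intro Pi_pmf_subset) auto
  have "P = map_pmf (\<lambda>(V, W) k. if k \<in> I then V k else W k) (pair_pmf (Pi_pmf I 0 (\<lambda>_. D)) (Pi_pmf J 0 (\<lambda>_. D)))"
    unfolding P_def iid_sizes_def IJ(1) using IJ by (intro Pi_pmf_union) auto
  also have "\<dots> = map_pmf mix (pair_pmf P P)"
    unfolding sub[of I, simplified] sub[of J, simplified] map_pair[symmetric] map_pmf_comp
    by (intro map_pmf_cong refl) (auto simp: mix_def fun_eq_iff)
  finally have P: "P = map_pmf mix (pair_pmf P P)" .
  have mix: "batches q (mix (V, W)) 1 T = batches q V 1 1 + batches q W 2 T" for V W
  proof -
    have "batches q (mix (V, W)) 1 T = batches q (mix (V, W)) 1 1 + batches q (mix (V, W)) 2 T"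
      using assms by (simp add: batches_batch sum.atLeast_Suc_atMost numeral_2_eq_2)
    also have "batches q (mix (V, W)) 1 1 = batches q V 1 1"
      by (intro batches_cong) (auto simp: mix_def I_def)
    also have "batches q (mix (V, W)) 2 T = batches q W 2 T"
      by (intro batches_cong) (auto simp: mix_def I_def J_def)
    finally show ?thesis .
  qed
  have "measure_pmf.expectation P (\<lambda>V. f (batches q V 1 T))
      = measure_pmf.expectation (pair_pmf P P) (\<lambda>x. f (batches q (mix x) 1 T))"
    by (subst P) simp
  also have "(\<lambda>x. f (batches q (mix x) 1 T)) = (\<lambda>(V, W). f (batches q V 1 1 + batches q W 2 T))"
  proof
    fix x show "f (batches q (mix x) 1 T) = (case x of (V, W) \<Rightarrow> f (batches q V 1 1 + batches q W 2 T))"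
      by (cases x) (simp only: mix prod.case)
  qed
  finally show ?thesis unfolding P_def by simp
qed

lemma expectation_oso_cost_le:
  assumes "T \<ge> 1" "q \<ge> 2" "B \<ge> 1" and D: "set_pmf D \<subseteq> {1..B}" and slv: "optimal_solver B q T slv"
  shows "measure_pmf.expectation (pair_pmf (iid_sizes T q D) (iid_sizes T q D))
       (\<lambda>(V, W). real (oso_cost slv T V W))
     \<le> measure_pmf.expectation (iid_sizes T q D) (\<lambda>V. real (opt_bins B (batches q V 1 T)))
       + real T * (5 * sqrt (real q * ln (real q)))"
proof -
  define P where "P = pair_pmf (iid_sizes T q D) (iid_sizes T q D)"
  have "finite (set_pmf P)" unfolding P_def using set_iid_sizes(1)[OF D] by simp
  then have int: "integrable (measure_pmf P) h" for h :: "sizes \<times> sizes \<Rightarrow> real"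
    by (rule integrable_measure_pmf_finite)
  have "measure_pmf.expectation P (\<lambda>(V, W). real (oso_cost slv T V W))
      \<le> measure_pmf.expectation P (\<lambda>x. (case x of (V, W) \<Rightarrow> real (opt_bins B (batches q V 1 1 + batches q W 2 T)))
        + (\<Sum>t=2..T. case x of (V, W) \<Rightarrow> real (excess (batch q V t) (batch q W t))))"
  proof (intro integral_mono_AE int, unfold AE_measure_pmf_iff, safe)
    fix V W assume VW: "(V, W) \<in> set_pmf P"
    have "set_mset (batch q U u) \<subseteq> {1..B}" if "U \<in> set_pmf (iid_sizes T q D)" "u \<in> {1..T}" for U u
      using set_iid_sizes(2)[OF D that(1)] that(2) by (auto simp: batch_def)
    then have "oso_cost slv T V W \<le> opt_bins B (batches q V 1 1 + batches q W 2 T)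
        + (\<Sum>t=2..T. excess (batch q V t) (batch q W t))"
      using VW unfolding P_def by (intro oso_cost_le[OF assms(3,1) slv]) auto
    then show "real (oso_cost slv T V W) \<le> real (opt_bins B (batches q V 1 1 + batches q W 2 T))
        + (\<Sum>t=2..T. real (excess (batch q V t) (batch q W t)))"
      by (metis of_nat_add of_nat_le_iff of_nat_sum)
  qed
  also have "\<dots> = measure_pmf.expectation (iid_sizes T q D) (\<lambda>V. real (opt_bins B (batches q V 1 T)))
      + (\<Sum>t=2..T. measure_pmf.expectation P (\<lambda>(V, W). real (excess (batch q V t) (batch q W t))))"
    using expectation_opt_bins_resampled[OF assms(1), of q D "\<lambda>M. real (opt_bins B M)"]
    by (simp add: int Bochner_Integration.integral_add Bochner_Integration.integral_sum P_def[symmetric])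
  also have "(\<Sum>t=2..T. measure_pmf.expectation P (\<lambda>(V, W). real (excess (batch q V t) (batch q W t))))
      \<le> (\<Sum>t=2..T. 5 * sqrt (real q * ln (real q)))"
    unfolding P_def using assms(2) by (intro sum_mono expectation_excess_le[OF D]) auto
  also have "\<dots> \<le> real T * (5 * sqrt (real q * ln (real q)))"
    using assms(2) by (simp add: mult_right_mono)
  finally show ?thesis unfolding P_def by simp
qed

theorem theorem2:
  "\<exists>c > 0. \<exists>C > 0. \<forall>(T :: nat) (q :: nat) (B :: nat) (D :: nat pmf) (slv :: solver).
     T \<ge> 1 \<longrightarrow> q \<ge> 1 \<longrightarrow> B \<ge> 1 \<longrightarrow> set_pmf D \<subseteq> {1..B} \<longrightarrow> optimal_solver B q T slv \<longrightarrow>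
     sqrt (real q) * (ln (real q) powr (3/4)) * exp (c * ln (real q) powr (3/2)) \<ge> real (T * q) \<longrightarrow>
     measure_pmf.expectation (pair_pmf (iid_sizes T q D) (iid_sizes T q D))
       (\<lambda>(V, W). real (oso_cost slv T V W))
     \<le> measure_pmf.expectation (iid_sizes T q D) (\<lambda>V. real (opt_bins B (batches q V 1 T)))
       + C * (real (T * q) * ln (real q) powr (3/4) / sqrt (real q))"
proof (rule exI[of _ 1], rule conjI[OF zero_less_one], rule exI[of _ 10], rule conjI, simp, intro allI impI)
  fix T q B :: nat and D :: "nat pmf" and slv :: solver
  assume T: "T \<ge> 1" and q: "q \<ge> 1" and B: "B \<ge> 1" and D: "set_pmf D \<subseteq> {1..B}"
    and slv: "optimal_solver B q T slv"
    and n: "sqrt (real q) * (ln (real q) powr (3/4)) * exp (1 * ln (real q) powr (3/2)) \<ge> real (T * q)"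
  \<comment> \<open>For \<open>q = 1\<close> the logarithm vanishes, and with it the left-hand side of \<open>n\<close>.\<close>
  have "q \<noteq> 1"
  proof
    assume "q = 1"
    with n T show False by simp
  qed
  with q have q2: "q \<ge> 2" by simp
  define L where "L = ln (real q)"
  have "ln 2 \<le> L" using q2 by (simp add: L_def)
  then have L: "1 / 2 \<le> L" using ln_2_ge_half by linarith
  \<comment> \<open>As \<open>L\<close> is bounded away from 0, \<open>sqrt L\<close> is at most a constant times \<open>L powr (3 / 4)\<close>.\<close>
  have "1 / 2 \<le> L powr (1 / 4)"
  proof (cases "L \<le> 1")
    case True
    have "1 / 2 \<le> L powr 1" using L by simp
    also have "\<dots> \<le> L powr (1 / 4)" by (rule powr_mono') (use L True in auto)
    finally show ?thesis .
  next
    case False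
    then have "1 \<le> L powr (1 / 4)" by (intro ge_one_powr_ge_zero) auto
    then show ?thesis by linarith
  qed
  then have "L powr (1 / 2) \<le> 2 * L powr (1 / 4) * L powr (1 / 2)"
    using mult_right_mono[of "1 / 2" "L powr (1 / 4)" "L powr (1 / 2)"] by simp
  also have "\<dots> = 2 * L powr (3 / 4)"
    using powr_add[of L "1 / 4" "1 / 2"] by simp
  finally have "sqrt L \<le> 2 * L powr (3 / 4)" using L by (simp add: powr_half_sqrt)
  then have "real T * (5 * sqrt (real q * L)) \<le> real T * (5 * (sqrt (real q) * (2 * L powr (3 / 4))))"
    unfolding real_sqrt_mult by (intro mult_left_mono) auto
  also have "\<dots> = 10 * (real T * (real q / sqrt (real q)) * L powr (3 / 4))"
    by (simp only: real_div_sqrt of_nat_0_le_iff mult_ac)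
  also have "\<dots> = 10 * (real (T * q) * L powr (3 / 4) / sqrt (real q))"
    by simp
  finally show "measure_pmf.expectation (pair_pmf (iid_sizes T q D) (iid_sizes T q D))
       (\<lambda>(V, W). real (oso_cost slv T V W))
     \<le> measure_pmf.expectation (iid_sizes T q D) (\<lambda>V. real (opt_bins B (batches q V 1 T)))
       + 10 * (real (T * q) * ln (real q) powr (3/4) / sqrt (real q))"
    using expectation_oso_cost_le[OF T q2 B D slv] unfolding L_def by linarith
qed

end
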